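(* The fish product of $3$-plexes is associative in the following sense: there exists a concurrent plex rewrite system with the fish as motif. Furthermore, the (minimal) symbolic condition that derives from the confluence of rewrites is the defining axiom of semiheaps, that is, $$((abc)de)=(a(dcb)e)=(ab(cde)).$$
   Context: **Plex diagrams.** A plex diagram is a simple connected hypergraph together with a set of marked vertices. Vertices represent indices; a hyperedge on $n$ vertices represents an $n$-plex (an array of order $n$ with values in a fixed commutative semiring $V$, considered up to reordering of its indices); marked vertices represent indices that are contracted (summed over), and unmarked vertices are called free. A diagram represents the plex obtained by multiplying the entries of all its hyperedges and summing over all marked indices; this is a plex on the free vertices. **The fish.** The fish is the plex diagram with vertices $t_1,t_2,p,q,r,m$, hyperedges $\{t_1,t_2,p\}$ (tail), $\{p,q,r\}$ (body), $\{q,r,m\}$ (head), and marked vertices $p,q,r$. If tail, body, head are labelled $x,y,z$, the resulting $3$-plex, on the free vertices $t_1,t_2,m$, is called the fish product of $x,y,z$ and is labelled by the bracketed word $(xyz)$, read from tail to head. **Motif rewrites.** A motif is a fixed plex diagram without labels. An occurrence of the motif in a plex diagram $D$ is a subhypergraph of $D$ isomorphic to the motif, the vertices corresponding to marked vertices of the motif being marked in $D$ and belonging to no other hyperedge of $D$. The corresponding rewrite replaces the hyperedges of the occurrence by the single hyperedge representing their product (for the fish: the hyperedge on the images of $t_1,t_2,m$, labelled $(xyz)$, where $x,y,z$ label the tail, body and head of the occurrence), leaving the rest of the diagram unchanged. A plex rewrite system consists of an initial plex diagram and all sequences of rewrites starting from it. **Concurrent.** A rewrite system is confluent if all the different sequences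 of rewrites lead to the same final diagram (ignoring labels), a single plex. It is called concurrent if it is confluent and moreover: (single motif) it is generated by a single rewrite rule, defined by detection of a single motif; (regularity) all plexes in the initial diagram and in all intermediate rewrites have the same order; (overlap) the motifs that occur in the initial diagram have non-empty intersection, i.e. they have overlapping plexes. A plex product given by a plex diagram is called associative if there exists a concurrent rewrite system taking that diagram as motif. **Symbolic condition.** Label the hyperedges of the initial diagram by letters and write the labels of composed plexes in brackets. The symbolic condition that derives from the confluence of rewrites is the equality of all the bracketed words obtained for the final plex through the different sequences of rewrites. **Semiheap.** A semiheap is a set $H$ with a ternary operation $(a,b,c)\mapsto (abc)$ such that $((abc)de)=(a(dcb)e)=(ab(cde))$ for all $a,b,c,d,e\in H$. *)

theory Defs
  imports Main
begin

section \<open>Plex diagrams\<close>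

datatype 'l word = Letter 'l | Bracket "'l word list"

text \<open>
  A hyperedge is stored together with its label. The labels in a rewrite system are pairwise
  different (see \<open>initial_diagram\<close>), so should a rewrite produce a hyperedge on a vertex set that
  already carries one, then the two plexes are kept apart rather than identified.
\<close>

record ('v, 'l) diagram =
  verts :: "'v set"
  edges :: "('v set \<times> 'l word) set"
  marked :: "'v set"

definition unlabel :: "('v, 'l) diagram \<Rightarrow> 'v set \<times> 'v set set \<times> 'v set" where
  "unlabel D = (verts D, fst ` edges D, marked D)"

text \<open>
  Hyperedges form a set, so this hypergraph is simple. At least one hyperedge is required, and
  with connectedness this excludes isolated vertices.
\<close>

definition plex_diagram :: "'v set \<times> 'v set set \<times> 'v set \<Rightarrow> bool" where
  "plex_diagram = (\<lambda>(V, E, K).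
     finite V \<and> E \<noteq> {} \<and> {} \<notin> E \<and> \<Union>E \<subseteq> V \<and> K \<subseteq> V \<and>
     (\<forall>u\<in>V. \<forall>v\<in>V. (u, v) \<in> {(x, y). \<exists>e\<in>E. x \<in> e \<and> y \<in> e}\<^sup>*))"

definition initial_diagram :: "('v, 'l) diagram \<Rightarrow> bool" where
  "initial_diagram D \<longleftrightarrow>
     plex_diagram (unlabel D) \<and> inj_on fst (edges D) \<and>
     inj_on snd (edges D) \<and> snd ` edges D \<subseteq> range Letter"


section \<open>Motifs and rewrites\<close>

text \<open>
  The hyperedges of a motif are listed in the order in which their labels are read when the
  label of the product is formed.
\<close>

record 'w motif =
  mverts :: "'w set"
  medges :: "'w set list"
  mmarked :: "'w set"

definition motif :: "'w motif \<Rightarrow> bool" where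
  "motif M \<longleftrightarrow> plex_diagram (mverts M, set (medges M), mmarked M) \<and> distinct (medges M)"

definition motif_image :: "'w motif \<Rightarrow> ('w \<Rightarrow> 'v) \<Rightarrow> 'l word list \<Rightarrow> ('v set \<times> 'l word) set" where
  "motif_image M \<phi> ws = set (zip (map ((`) \<phi>) (medges M)) ws)"

definition occurs :: "'w motif \<Rightarrow> ('w \<Rightarrow> 'v) \<Rightarrow> 'l word list \<Rightarrow> ('v, 'l) diagram \<Rightarrow> bool" where
  "occurs M \<phi> ws D \<longleftrightarrow>
     inj_on \<phi> (mverts M) \<and> \<phi> ` mverts M \<subseteq> verts D \<and>
     length ws = length (medges M) \<and> motif_image M \<phi> ws \<subseteq> edges D \<and>
     \<phi> ` mmarked M \<subseteq> marked D \<and>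
     (\<forall>(e, w) \<in> edges D - motif_image M \<phi> ws. e \<inter> \<phi> ` mmarked M = {})"

text \<open>
  An occurrence is a subhypergraph, not an embedding: embeddings that differ by a symmetry of the
  motif give the same occurrence. As a motif has no isolated vertices, the subhypergraph is
  determined by its hyperedges.
\<close>

definition occurrences :: "'w motif \<Rightarrow> ('v, 'l) diagram \<Rightarrow> ('v set \<times> 'l word) set set" where
  "occurrences M D = {motif_image M \<phi> ws | \<phi> ws. occurs M \<phi> ws D}"

definition rewrite :: "'w motif \<Rightarrow> ('v, 'l) diagram \<Rightarrow> ('v, 'l) diagram \<Rightarrow> bool" where
  "rewrite M D D' \<longleftrightarrow> (\<exists>\<phi> ws. occurs M \<phi> ws D \<and>
     D' = \<lparr>verts = verts D - \<phi> ` mmarked M,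
           edges = insert (\<phi> ` (mverts M - mmarked M), Bracket ws)
                     (edges D - motif_image M \<phi> ws),
           marked = marked D - \<phi> ` mmarked M\<rparr>)"

definition finals :: "'w motif \<Rightarrow> ('v, 'l) diagram \<Rightarrow> ('v, 'l) diagram set" where
  "finals M D = {F. (rewrite M)\<^sup>*\<^sup>* D F \<and> (\<nexists>F'. rewrite M F F')}"


section \<open>Concurrent rewrite systems\<close>

text \<open>The rewrite system is the one generated by the motif \<open>M\<close> from the initial diagram \<open>D\<close>.\<close>

definition confluent :: "'w motif \<Rightarrow> ('v, 'l) diagram \<Rightarrow> bool" where
  "confluent M D \<longleftrightarrow> finals M D \<noteq> {} \<and> (\<forall>F \<in> finals M D. card (edges F) = 1) \<and>
     (\<forall>F \<in> finals M D. \<forall>G \<in> finals M D. unlabel F = unlabel G)"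

definition regular :: "'w motif \<Rightarrow> ('v, 'l) diagram \<Rightarrow> bool" where
  "regular M D \<longleftrightarrow>
     (\<exists>n. \<forall>D'. (rewrite M)\<^sup>*\<^sup>* D D' \<longrightarrow> (\<forall>(e, w) \<in> edges D'. card e = n))"

text \<open>
  Overlap concerns several occurrences. If a single one were admitted, then the motif itself
  would be the smallest concurrent system, with an empty symbolic condition.
\<close>

definition overlapping :: "'w motif \<Rightarrow> ('v, 'l) diagram \<Rightarrow> bool" where
  "overlapping M D \<longleftrightarrow>
     (\<exists>X \<in> occurrences M D. \<exists>Y \<in> occurrences M D. X \<noteq> Y) \<and> \<Inter>(occurrences M D) \<noteq> {}"

definition concurrent :: "'w motif \<Rightarrow> ('v, 'l) diagram \<Rightarrow> bool" where
  "concurrent M D \<longleftrightarrow> motif M \<and> initial_diagram D \<and>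
     confluent M D \<and> regular M D \<and> overlapping M D"

text \<open>Diagrams are finite, so vertices and letters can be taken to be natural numbers.\<close>

definition associative :: "'w motif \<Rightarrow> bool" where
  "associative M \<longleftrightarrow> (\<exists>D :: (nat, nat) diagram. concurrent M D)"


section \<open>The symbolic condition\<close>

definition final_words :: "'w motif \<Rightarrow> ('v, 'l) diagram \<Rightarrow> 'l word set" where
  "final_words M D = (\<Union>F \<in> finals M D. snd ` edges F)"

primrec eval_word :: "('h list \<Rightarrow> 'h) \<Rightarrow> ('l \<Rightarrow> 'h) \<Rightarrow> 'l word \<Rightarrow> 'h" where
  "eval_word f \<rho> (Letter x) = \<rho> x"
| "eval_word f \<rho> (Bracket ws) = f (map (eval_word f \<rho>) ws)"

definition symbolic_condition ::
    "'w motif \<Rightarrow> ('v, 'l) diagram \<Rightarrow> 'h set \<Rightarrow> ('h list \<Rightarrow> 'h) \<Rightarrow> bool" where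
  "symbolic_condition M D H f \<longleftrightarrow>
     (\<forall>\<rho>. (\<forall>x. \<rho> x \<in> H) \<longrightarrow>
        (\<forall>w \<in> final_words M D. \<forall>w' \<in> final_words M D. eval_word f \<rho> w = eval_word f \<rho> w'))"


section \<open>The fish and semiheaps\<close>

datatype fish_vertex = vt1 | vt2 | vp | vq | vr | vm

text \<open>Tail, body and head, in this order.\<close>

definition fish :: "fish_vertex motif" where
  "fish = \<lparr>mverts = {vt1, vt2, vp, vq, vr, vm},
           medges = [{vt1, vt2, vp}, {vp, vq, vr}, {vq, vr, vm}],
           mmarked = {vp, vq, vr}\<rparr>"

abbreviation fish_word :: "'l word \<Rightarrow> 'l word \<Rightarrow> 'l word \<Rightarrow> 'l word" where
  "fish_word x y z \<equiv> Bracket [x, y, z]"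

definition ternary :: "('h \<Rightarrow> 'h \<Rightarrow> 'h \<Rightarrow> 'h) \<Rightarrow> 'h list \<Rightarrow> 'h" where
  "ternary t xs = t (xs ! 0) (xs ! 1) (xs ! 2)"

definition ternary_closed :: "'h set \<Rightarrow> ('h \<Rightarrow> 'h \<Rightarrow> 'h \<Rightarrow> 'h) \<Rightarrow> bool" where
  "ternary_closed H t \<longleftrightarrow> (\<forall>a\<in>H. \<forall>b\<in>H. \<forall>c\<in>H. t a b c \<in> H)"

definition semiheap :: "'h set \<Rightarrow> ('h \<Rightarrow> 'h \<Rightarrow> 'h \<Rightarrow> 'h) \<Rightarrow> bool" where
  "semiheap H t \<longleftrightarrow> ternary_closed H t \<and>
     (\<forall>a\<in>H. \<forall>b\<in>H. \<forall>c\<in>H. \<forall>d\<in>H. \<forall>e\<in>H.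
        t (t a b c) d e = t a (t d c b) e \<and> t a (t d c b) e = t a b (t c d e))"

end

theory Submission
  imports Defs
begin

text \<open>
  An occurrence of the fish is the same as three hyperedges of order 3, a tail, a body and a head,
  such that tail and body share one vertex, body and head share two, tail and head share none, and
  the body is marked and meets no other hyperedge. In the chain of five plexes a, b, c, d, e whose
  consecutive members share alternately one and two vertices this happens in three ways, (abc),
  (dcb) and (cde). Each rewrite leaves a fish, whose rewrite leaves a plex on the same three free
  vertices. The body (dcb) is read backwards because the single vertex that c shares with another
  plex lies on the side of d.
\<close>

section \<open>Connected hypergraphs\<close>

lemma plex_diagram_single:
  assumes "finite e" "e \<noteq> {}" "K \<subseteq> e"
  shows "plex_diagram (e, {e}, K)"
  using assms by (auto simp: plex_diagram_def)

text \<open>A vertex \<open>w\<close> shared by \<open>e\<close> and \<open>V\<close> is linked in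
  both directions to every old vertex by the old paths and to every vertex of \<open>e\<close> in
  one step, so all pairs are linked through \<open>w\<close>. This allows hypergraphs to be built
  edge by edge. Since \<open>K'\<close> is independent of \<open>K\<close>, marks can wait until the
  last edge.\<close>

lemma plex_diagram_insert:
  assumes D: "plex_diagram (V, E, K)" and e: "finite e" "e \<inter> V \<noteq> {}" and K': "K' \<subseteq> V \<union> e"
  shows "plex_diagram (V \<union> e, insert e E, K')"
proof -
  define R where "R = {(x, y). \<exists>f\<in>E. x \<in> f \<and> y \<in> f}"
  define R' where "R' = {(x, y). \<exists>f\<in>insert e E. x \<in> f \<and> y \<in> f}"
  have "R\<^sup>* \<subseteq> R'\<^sup>*"
    by (rule rtrancl_mono) (auto simp: R_def R'_def)
  obtain w where w: "w \<in> e" "w \<in> V"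
    using e by blast
  have "(u, w) \<in> R'\<^sup>* \<and> (w, u) \<in> R'\<^sup>*" if "u \<in> V \<union> e" for u
  proof (cases "u \<in> V")
    case True
    then have "(u, w) \<in> R\<^sup>*" "(w, u) \<in> R\<^sup>*"
      using D w by (auto simp: plex_diagram_def R_def)
    then show ?thesis
      using \<open>R\<^sup>* \<subseteq> R'\<^sup>*\<close> by blast
  next
    case False
    then have "(u, w) \<in> R'" "(w, u) \<in> R'"
      using that w by (auto simp: R'_def)
    then show ?thesis
      by blast
  qed
  then have "\<forall>u\<in>V \<union> e. \<forall>v\<in>V \<union> e. (u, v) \<in> R'\<^sup>*"
    by (meson rtrancl_trans)
  then show ?thesis
    using D e K' unfolding plex_diagram_def R'_def by auto
qed


section \<open>Occurrences of the fish\<close>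

text \<open>Stated through sizes of intersections instead of an embedding, so that on an explicit
  diagram it can be decided by evaluation. The arguments are tail, body, head.\<close>

definition fish_at ::
    "('v, 'l) diagram \<Rightarrow> 'v set \<times> 'l word \<Rightarrow> 'v set \<times> 'l word \<Rightarrow> 'v set \<times> 'l word \<Rightarrow> bool" where
  "fish_at D x y z \<longleftrightarrow>
     card (fst y \<inter> fst z) = 2 \<and> card (fst x \<inter> fst y) = 1 \<and> fst x \<inter> fst z = {} \<and>
     card (fst x) = 3 \<and> card (fst y) = 3 \<and> card (fst z) = 3 \<and>
     fst x \<union> fst y \<union> fst z \<subseteq> verts D \<and> fst y \<subseteq> marked D \<and>
     (\<forall>s \<in> edges D - {x, y, z}. fst s \<inter> fst y = {})"

text \<open>The marked vertices of an occurrence are exactly the vertices of its body.\<close>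

definition fish_contract ::
    "('v, 'l) diagram \<Rightarrow> 'v set \<times> 'l word \<Rightarrow> 'v set \<times> 'l word \<Rightarrow> 'v set \<times> 'l word \<Rightarrow>
     ('v, 'l) diagram" where
  "fish_contract D x y z =
     \<lparr>verts = verts D - fst y,
      edges = insert (fst x \<union> fst z - fst y, fish_word (snd x) (snd y) (snd z)) (edges D - {x, y, z}),
      marked = marked D - fst y\<rparr>"

lemma motif_image_fish:
  "motif_image fish \<phi> [x, y, z] =
     {({\<phi> vt1, \<phi> vt2, \<phi> vp}, x), ({\<phi> vp, \<phi> vq, \<phi> vr}, y), ({\<phi> vq, \<phi> vr, \<phi> vm}, z)}"
  by (auto simp: motif_image_def fish_def)

lemma occurs_fish_length:
  assumes "occurs fish \<phi> ws D"
  obtains x y z where "ws = [x, y, z]"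
  using assms by (auto simp: occurs_def fish_def length_Suc_conv)

text \<open>Injectivity makes the six image vertices distinct, so sizes and overlaps of the three
  image edges are those of the motif.\<close>

lemma occurs_fishD:
  assumes "occurs fish \<phi> [x, y, z] D"
  defines "T \<equiv> ({\<phi> vt1, \<phi> vt2, \<phi> vp}, x)" and "B \<equiv> ({\<phi> vp, \<phi> vq, \<phi> vr}, y)"
    and "H \<equiv> ({\<phi> vq, \<phi> vr, \<phi> vm}, z)"
  shows "T \<in> edges D" "B \<in> edges D" "H \<in> edges D" "fish_at D T B H"
    "\<phi> ` mmarked fish = fst B" "\<phi> ` (mverts fish - mmarked fish) = fst T \<union> fst H - fst B"
proof -
  have inj: "distinct [\<phi> vt1, \<phi> vt2, \<phi> vp, \<phi> vq, \<phi> vr, \<phi> vm]"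
    using assms(1) by (auto simp: occurs_def fish_def inj_on_def)
  show "T \<in> edges D" "B \<in> edges D" "H \<in> edges D"
    using assms by (auto simp: occurs_def motif_image_fish)
  show marked: "\<phi> ` mmarked fish = fst B"
    by (auto simp: fish_def B_def)
  show "\<phi> ` (mverts fish - mmarked fish) = fst T \<union> fst H - fst B"
    using inj by (auto simp: fish_def T_def B_def H_def)
  have "\<forall>s \<in> edges D - {T, B, H}. fst s \<inter> fst B = {}"
    using assms(1) unfolding occurs_def marked motif_image_fish
    by (elim conjE) (simp only: T_def B_def H_def case_prod_unfold)
  moreover have "fst T \<union> fst B \<union> fst H \<subseteq> verts D" "fst B \<subseteq> marked D"
    using assms(1) by (auto simp: occurs_def fish_def T_def B_def H_def)
  moreover have "fst B \<inter> fst H = {\<phi> vq, \<phi> vr}" "fst T \<inter> fst B = {\<phi> vp}" "fst T \<inter> fst H = {}"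
    using inj by (auto simp: T_def B_def H_def)
  ultimately show "fish_at D T B H"
    using inj unfolding fish_at_def by (simp add: T_def B_def H_def)
qed

text \<open>The overlaps recover the embedding: tail and body meet in the image of
  \<open>vp\<close>, body and head in those of \<open>vq\<close> and \<open>vr\<close>, and what
  remains of tail and head gives the free vertices. The order within the pairs \<open>q\<close>,
  \<open>r\<close> and \<open>t1\<close>, \<open>t2\<close> is an arbitrary choice, reflecting the
  symmetries of the fish.\<close>

lemma fish_at_occurs:
  assumes mem: "T \<in> edges D" "B \<in> edges D" "H \<in> edges D" and at: "fish_at D T B H"
  obtains \<phi> where "occurs fish \<phi> [snd T, snd B, snd H] D"
    "T = ({\<phi> vt1, \<phi> vt2, \<phi> vp}, snd T)" "B = ({\<phi> vp, \<phi> vq, \<phi> vr}, snd B)"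
    "H = ({\<phi> vq, \<phi> vr, \<phi> vm}, snd H)"
proof -
  have c: "card (fst T) = 3" "card (fst B) = 3" "card (fst H) = 3"
    using at by (auto simp: fish_at_def)
  then have fin: "finite (fst T)" "finite (fst B)" "finite (fst H)"
    by (auto intro: card_ge_0_finite)
  have "card (fst B \<inter> fst H) = 2" "card (fst T \<inter> fst B) = 1"
    using at by (simp_all add: fish_at_def)
  then obtain q r p where qr: "fst B \<inter> fst H = {q, r}" "q \<noteq> r" and p: "fst T \<inter> fst B = {p}"
    by (meson card_2_iff card_1_singletonE)
  have disj: "fst T \<inter> fst H = {}"
    using at by (simp add: fish_at_def)
  \<comment> \<open>\<open>p\<close> lies in the tail, \<open>q\<close> and \<open>r\<close> in the
    head, and these are disjoint.\<close>
  have pqr: "p \<noteq> q" "p \<noteq> r"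
    using p qr disj by auto
  have B: "fst B = {p, q, r}"
    by (rule card_subset_eq[symmetric]) (use p qr pqr fin c in auto)
  have "p \<in> fst T" "{q, r} \<subseteq> fst H"
    using p qr by blast+
  have "card (fst T - {p}) = 2"
    using \<open>p \<in> fst T\<close> c by simp
  then obtain t1 t2 where t: "fst T - {p} = {t1, t2}" "t1 \<noteq> t2"
    unfolding card_2_iff by blast
  have "card (fst H - {q, r}) = 1"
    using card_Diff_subset[OF _ \<open>{q, r} \<subseteq> fst H\<close>] qr c by simp
  then obtain m where m: "fst H - {q, r} = {m}"
    by (auto simp: card_1_singleton_iff)
  have T: "fst T = {t1, t2, p}" and H: "fst H = {q, r, m}"
    using t m p qr by auto
  have dist: "distinct [t1, t2, p, q, r, m]"
    using t m pqr qr disj unfolding T H by auto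
  define \<phi> where "\<phi> v = (case v of vt1 \<Rightarrow> t1 | vt2 \<Rightarrow> t2 | vp \<Rightarrow> p | vq \<Rightarrow> q | vr \<Rightarrow> r | vm \<Rightarrow> m)" for v
  have \<phi>: "\<phi> vt1 = t1" "\<phi> vt2 = t2" "\<phi> vp = p" "\<phi> vq = q" "\<phi> vr = r" "\<phi> vm = m"
    by (simp_all add: \<phi>_def)
  have eqs: "T = ({\<phi> vt1, \<phi> vt2, \<phi> vp}, snd T)" "B = ({\<phi> vp, \<phi> vq, \<phi> vr}, snd B)"
    "H = ({\<phi> vq, \<phi> vr, \<phi> vm}, snd H)"
    using T B H by (simp_all add: \<phi> prod_eq_iff)
  then have img: "motif_image fish \<phi> [snd T, snd B, snd H] = {T, B, H}"
    by (simp add: motif_image_fish)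
  have marked: "\<phi> ` mmarked fish = fst B"
    by (auto simp: fish_def \<phi> B)
  have verts: "\<phi> ` mverts fish = fst T \<union> fst B \<union> fst H"
    by (auto simp: fish_def \<phi> T B H)
  have "inj_on \<phi> (mverts fish)"
    using dist by (auto simp: fish_def inj_on_def \<phi>)
  moreover have "\<forall>(e, w) \<in> edges D - {T, B, H}. e \<inter> fst B = {}"
    using at unfolding fish_at_def case_prod_unfold by blast
  ultimately have "occurs fish \<phi> [snd T, snd B, snd H] D"
    using mem at unfolding occurs_def img marked verts by (simp add: fish_def fish_at_def)
  then show thesis
    using eqs by (rule that)
qed

lemma occurrences_fish:
  "occurrences fish D =
     {{x, y, z} | x y z. x \<in> edges D \<and> y \<in> edges D \<and> z \<in> edges D \<and> fish_at D x y z}"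
  (is "_ = ?R")
proof
  show "occurrences fish D \<subseteq> ?R"
  proof
    fix X assume "X \<in> occurrences fish D"
    then obtain \<phi> ws where o: "occurs fish \<phi> ws D" and X: "X = motif_image fish \<phi> ws"
      by (auto simp: occurrences_def)
    obtain x y z where "ws = [x, y, z]"
      using o by (rule occurs_fish_length)
    with o have o': "occurs fish \<phi> [x, y, z] D"
      by simp
    show "X \<in> ?R"
      unfolding X \<open>ws = [x, y, z]\<close> motif_image_fish mem_Collect_eq
      by (rule exI[of _ "({\<phi> vt1, \<phi> vt2, \<phi> vp}, x)"], rule exI[of _ "({\<phi> vp, \<phi> vq, \<phi> vr}, y)"],
          rule exI[of _ "({\<phi> vq, \<phi> vr, \<phi> vm}, z)"]) (simp only: occurs_fishD(1-4)[OF o'])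
  qed
  show "?R \<subseteq> occurrences fish D"
  proof
    fix X assume "X \<in> ?R"
    then obtain x y z where X: "X = {x, y, z}"
      and xyz: "x \<in> edges D" "y \<in> edges D" "z \<in> edges D" "fish_at D x y z"
      by blast
    obtain \<phi> where o: "occurs fish \<phi> [snd x, snd y, snd z] D"
      and eqs: "x = ({\<phi> vt1, \<phi> vt2, \<phi> vp}, snd x)" "y = ({\<phi> vp, \<phi> vq, \<phi> vr}, snd y)"
        "z = ({\<phi> vq, \<phi> vr, \<phi> vm}, snd z)"
      using xyz by (rule fish_at_occurs)
    have "X = motif_image fish \<phi> [snd x, snd y, snd z]"
      unfolding X motif_image_fish using eqs by simp
    then show "X \<in> occurrences fish D"
      using o by (auto simp: occurrences_def)
  qed
qed

lemma fish_at_in_occurrences: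
  assumes "x \<in> edges D" "y \<in> edges D" "z \<in> edges D" "fish_at D x y z"
  shows "{x, y, z} \<in> occurrences fish D"
  using assms unfolding occurrences_fish by blast

text \<open>The embedding enters a rewrite only through the contracted vertices, which form the
  body, and the free ones, which are the rest of tail and head. Hence the triple of labelled edges
  determines the result.\<close>

lemma rewrite_fish:
  "rewrite fish D D' \<longleftrightarrow>
     (\<exists>y\<in>edges D. \<exists>z\<in>edges D. \<exists>x\<in>edges D. fish_at D x y z \<and> D' = fish_contract D x y z)"
  (is "_ \<longleftrightarrow> ?R")
proof
  assume "rewrite fish D D'"
  then obtain \<phi> ws where o: "occurs fish \<phi> ws D" and
    D': "D' = \<lparr>verts = verts D - \<phi> ` mmarked fish,
      edges = insert (\<phi> ` (mverts fish - mmarked fish), Bracket ws) (edges D - motif_image fish \<phi> ws),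
      marked = marked D - \<phi> ` mmarked fish\<rparr>"
    unfolding rewrite_def by blast
  obtain x y z where ws: "ws = [x, y, z]"
    using o by (rule occurs_fish_length)
  note o' = occurs_fishD[OF o[unfolded ws]]
  let ?T = "({\<phi> vt1, \<phi> vt2, \<phi> vp}, x)" and ?B = "({\<phi> vp, \<phi> vq, \<phi> vr}, y)"
    and ?H = "({\<phi> vq, \<phi> vr, \<phi> vm}, z)"
  have "D' = fish_contract D ?T ?B ?H"
    unfolding D' ws motif_image_fish o' fish_contract_def by simp
  then show ?R
    using o' by blast
next
  assume ?R
  then obtain x y z where D': "D' = fish_contract D x y z"
    and xyz: "x \<in> edges D" "y \<in> edges D" "z \<in> edges D" "fish_at D x y z"
    by blast
  obtain \<phi> where o: "occurs fish \<phi> [snd x, snd y, snd z] D"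
    and eqs: "x = ({\<phi> vt1, \<phi> vt2, \<phi> vp}, snd x)" "y = ({\<phi> vp, \<phi> vq, \<phi> vr}, snd y)"
      "z = ({\<phi> vq, \<phi> vr, \<phi> vm}, snd z)"
    using xyz by (rule fish_at_occurs)
  have "motif_image fish \<phi> [snd x, snd y, snd z] = {x, y, z}"
    unfolding motif_image_fish using eqs by simp
  moreover have "\<phi> ` mmarked fish = fst y" "\<phi> ` (mverts fish - mmarked fish) = fst x \<union> fst z - fst y"
    using occurs_fishD(5,6)[OF o] eqs by simp_all
  ultimately show "rewrite fish D D'"
    unfolding rewrite_def using o D'
    by (intro exI[of _ \<phi>] exI[of _ "[snd x, snd y, snd z]"]) (simp add: fish_contract_def)
qed

text \<open>Two coinciding edges would overlap in three vertices, whereas the prescribed overlaps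
  have sizes 2, 1 and 0.\<close>

lemma card_fish_at:
  assumes "fish_at D x y z"
  shows "card {x, y, z} = 3"
proof -
  have "x \<noteq> y" "y \<noteq> z" "x \<noteq> z"
    using assms by (auto simp: fish_at_def)
  then show ?thesis
    by simp
qed


section \<open>The minimal concurrent system\<close>

text \<open>The vertex sets of the edges are subsets of a finite set, and each carries only one
  label.\<close>

lemma finite_edges_initial:
  assumes "initial_diagram D"
  shows "finite (edges D)"
proof (rule finite_imageD)
  have "finite (\<Union> (fst ` edges D))"
    using assms finite_subset
    unfolding initial_diagram_def plex_diagram_def unlabel_def by (auto simp only: prod.case)
  then show "finite (fst ` edges D)"
    by (rule finite_UnionD)
  show "inj_on fst (edges D)"
    using assms by (simp add: initial_diagram_def)
qed

text \<open>
  Two different overlapping fish need at least four hyperedges. With exactly four, one rewrite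
  leaves two hyperedges, so it gets stuck before reaching a single plex.
\<close>

lemma concurrent_fish_card_ge_5:
  assumes "concurrent fish D"
  shows "5 \<le> card (edges D)"
proof (rule ccontr)
  assume less: "\<not> 5 \<le> card (edges D)"
  have init: "initial_diagram D" and conf: "confluent fish D"
    using assms by (simp_all add: concurrent_def)
  note fin = finite_edges_initial[OF init]
  obtain X Y where X: "X \<in> occurrences fish D" and Y: "Y \<in> occurrences fish D" and "X \<noteq> Y"
    using assms unfolding concurrent_def overlapping_def by blast
  have XY: "X \<subseteq> edges D" "card X = 3" "Y \<subseteq> edges D" "card Y = 3"
    using X Y by (auto simp: occurrences_fish dest: card_fish_at)
  \<comment> \<open>Otherwise \<open>Y\<close>, a 3-element subset of a 3-element set, would equal
    \<open>X\<close>.\<close>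
  have "X \<noteq> edges D"
    using XY \<open>X \<noteq> Y\<close> card_subset_eq[OF fin XY(3)] by auto
  then have card4: "card (edges D) = 4"
    using psubset_card_mono[OF fin, of X] XY less by (simp add: psubset_eq)
  obtain x y z where xyz: "X = {x, y, z}" "x \<in> edges D" "y \<in> edges D" "z \<in> edges D"
    and at: "fish_at D x y z"
    using X unfolding occurrences_fish by blast
  define D' where "D' = fish_contract D x y z"
  have step: "rewrite fish D D'"
    unfolding rewrite_fish D'_def using xyz at by blast
  define n where "n = (fst x \<union> fst z - fst y, fish_word (snd x) (snd y) (snd z))"
  \<comment> \<open>Initial labels are letters and \<open>n\<close> carries a bracket, so
    \<open>n\<close> cannot merge with the surviving edge and the count after the rewrite is exactly
    two.\<close>
  have "snd n \<notin> snd ` edges D"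
    using init by (auto simp: n_def initial_diagram_def)
  then have "n \<notin> edges D - X"
    by blast
  moreover have "card (edges D - X) = 1"
    using card_Diff_subset[of X "edges D"] XY card4 finite_subset[OF XY(1) fin] by simp
  moreover have "edges D' = insert n (edges D - X)"
    by (simp add: D'_def n_def fish_contract_def xyz)
  ultimately have card2: "card (edges D') = 2"
    using fin by simp
  have "\<nexists>F. rewrite fish D' F"
  proof
    assume "\<exists>F. rewrite fish D' F"
    then obtain u v w where "{u, v, w} \<subseteq> edges D'" "fish_at D' u v w"
      by (auto simp: rewrite_fish)
    then have "3 \<le> card (edges D')"
      using card_mono[of "edges D'" "{u, v, w}"] card2 card_fish_at[of D' u v w]
      by (metis card.infinite zero_neq_numeral)
    then show False
      using card2 by simp
  qed
  then have "D' \<in> finals fish D"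
    using step by (auto simp: finals_def)
  then show False
    using conf card2 by (auto simp: confluent_def)
qed

section \<open>The chain of five plexes and its rewrites\<close>

text \<open>
  The chain is a - b = c - d = e, in which a single bar stands for one and a double bar for two
  shared vertices. A double bar with an adjacent single bar is a fish; its tail is at the far
  end of the single bar.
\<close>

abbreviation ea :: "nat set \<times> nat word" where "ea \<equiv> ({1, 2, 3}, Letter 0)"
abbreviation eb :: "nat set \<times> nat word" where "eb \<equiv> ({3, 4, 5}, Letter 1)"
abbreviation ec :: "nat set \<times> nat word" where "ec \<equiv> ({4, 5, 6}, Letter 2)"
abbreviation ed :: "nat set \<times> nat word" where "ed \<equiv> ({6, 7, 8}, Letter 3)"
abbreviation ee :: "nat set \<times> nat word" where "ee \<equiv> ({7, 8, 9}, Letter 4)"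

definition chain :: "(nat, nat) diagram" where
  "chain = \<lparr>verts = {1, 2, 3, 4, 5, 6, 7, 8, 9}, edges = {ea, eb, ec, ed, ee},
     marked = {3, 4, 5, 6, 7, 8}\<rparr>"

abbreviation wabc :: "nat word" where "wabc \<equiv> fish_word (Letter 0) (Letter 1) (Letter 2)"
abbreviation wdcb :: "nat word" where "wdcb \<equiv> fish_word (Letter 3) (Letter 2) (Letter 1)"
abbreviation wcde :: "nat word" where "wcde \<equiv> fish_word (Letter 2) (Letter 3) (Letter 4)"

text \<open>In the three intermediate diagrams, the body of the remaining fish is \<open>ed\<close>,
  the new plex labelled \<open>wdcb\<close>, and \<open>eb\<close>, respectively.\<close>

definition chain_abc :: "(nat, nat) diagram" where
  "chain_abc = \<lparr>verts = {1, 2, 6, 7, 8, 9}, edges = {({1, 2, 6}, wabc), ed, ee}, marked = {6, 7, 8}\<rparr>"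

definition chain_dcb :: "(nat, nat) diagram" where
  "chain_dcb = \<lparr>verts = {1, 2, 3, 7, 8, 9}, edges = {ea, ({3, 7, 8}, wdcb), ee}, marked = {3, 7, 8}\<rparr>"

definition chain_cde :: "(nat, nat) diagram" where
  "chain_cde = \<lparr>verts = {1, 2, 3, 4, 5, 9}, edges = {ea, eb, ({4, 5, 9}, wcde)}, marked = {3, 4, 5}\<rparr>"

definition single_plex :: "nat word \<Rightarrow> (nat, nat) diagram" where
  "single_plex w = \<lparr>verts = {1, 2, 9}, edges = {({1, 2, 9}, w)}, marked = {}\<rparr>"

text \<open>The end plexes contain free vertices and cannot be bodies. Each inner plex has one
  single and one double bar, which fix its tail and its head. The proof checks all 125
  triples.\<close>

lemma fish_at_chain:
  assumes "x \<in> edges chain" "y \<in> edges chain" "z \<in> edges chain"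
  shows "fish_at chain x y z \<longleftrightarrow> (x, y, z) \<in> {(ea, eb, ec), (ed, ec, eb), (ec, ed, ee)}"
  using assms unfolding chain_def
  by (simp, elim disjE) (simp_all add: fish_at_def insert_Diff_if Int_insert_left)

lemma rewrite_chain: "rewrite fish chain D \<longleftrightarrow> D \<in> {chain_abc, chain_dcb, chain_cde}"
proof -
  have abc: "fish_contract chain ea eb ec = chain_abc"
    by (auto simp: fish_contract_def chain_def chain_abc_def insert_Diff_if)
  have dcb: "fish_contract chain ed ec eb = chain_dcb"
    by (auto simp: fish_contract_def chain_def chain_dcb_def insert_Diff_if)
  have cde: "fish_contract chain ec ed ee = chain_cde"
    by (auto simp: fish_contract_def chain_def chain_cde_def insert_Diff_if)
  have "ea \<in> edges chain" "eb \<in> edges chain" "ec \<in> edges chain" "ed \<in> edges chain" "ee \<in> edges chain"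
    by (simp_all add: chain_def)
  then show ?thesis
    \<comment> \<open>With the named diagrams turned back into contractions, only the list of
      triples in \<open>fish_at_chain\<close> is left to compare.\<close>
    unfolding rewrite_fish abc[symmetric] dcb[symmetric] cde[symmetric]
    by (auto simp: fish_at_chain simp del: insert_iff)
qed

lemma rewrite_chain_abc:
  "rewrite fish chain_abc D \<longleftrightarrow> D = single_plex (fish_word wabc (Letter 3) (Letter 4))"
  by (simp add: rewrite_fish chain_abc_def fish_at_def fish_contract_def single_plex_def
      insert_Diff_if Int_insert_left)

lemma rewrite_chain_dcb:
  "rewrite fish chain_dcb D \<longleftrightarrow> D = single_plex (fish_word (Letter 0) wdcb (Letter 4))"
  by (simp add: rewrite_fish chain_dcb_def fish_at_def fish_contract_def single_plex_def
      insert_Diff_if Int_insert_left)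

lemma rewrite_chain_cde:
  "rewrite fish chain_cde D \<longleftrightarrow> D = single_plex (fish_word (Letter 0) (Letter 1) wcde)"
  by (simp add: rewrite_fish chain_cde_def fish_at_def fish_contract_def single_plex_def
      insert_Diff_if Int_insert_left)

lemma not_rewrite_single_plex: "\<not> rewrite fish (single_plex w) D"
  by (simp add: rewrite_fish single_plex_def fish_at_def)

abbreviation chain_words :: "nat word set" where
  "chain_words \<equiv> {fish_word wabc (Letter 3) (Letter 4), fish_word (Letter 0) wdcb (Letter 4),
     fish_word (Letter 0) (Letter 1) wcde}"

lemma reachable_chain:
  "(rewrite fish)\<^sup>*\<^sup>* chain D \<longleftrightarrow>
     D \<in> {chain, chain_abc, chain_dcb, chain_cde} \<union> single_plex ` chain_words"
proof -
  \<comment> \<open>First-step unfolding of reachability. It would loop as a simplification rule, so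
    it is substituted once per diagram, starting from the irreducible plexes and going back to the
    chain.\<close>
  have step: "(rewrite fish)\<^sup>*\<^sup>* A B \<longleftrightarrow> B = A \<or> (\<exists>C. rewrite fish A C \<and> (rewrite fish)\<^sup>*\<^sup>* C B)"
    for A B :: "(nat, nat) diagram"
    by (metis converse_rtranclpE converse_rtranclp_into_rtranclp rtranclp.rtrancl_refl)
  have single: "(rewrite fish)\<^sup>*\<^sup>* (single_plex w) B \<longleftrightarrow> B = single_plex w" for w B
    by (subst step) (simp add: not_rewrite_single_plex)
  have "(rewrite fish)\<^sup>*\<^sup>* chain_abc B \<longleftrightarrow>
      B = chain_abc \<or> B = single_plex (fish_word wabc (Letter 3) (Letter 4))"
    "(rewrite fish)\<^sup>*\<^sup>* chain_dcb B \<longleftrightarrow>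
      B = chain_dcb \<or> B = single_plex (fish_word (Letter 0) wdcb (Letter 4))"
    "(rewrite fish)\<^sup>*\<^sup>* chain_cde B \<longleftrightarrow>
      B = chain_cde \<or> B = single_plex (fish_word (Letter 0) (Letter 1) wcde)" for B
    by (subst step, simp add: rewrite_chain_abc rewrite_chain_dcb rewrite_chain_cde single)+
  then show ?thesis
    by (subst step) (auto simp: rewrite_chain)
qed

lemma finals_chain: "finals fish chain = single_plex ` chain_words"
  unfolding finals_def reachable_chain
  by (auto simp: rewrite_chain rewrite_chain_abc rewrite_chain_dcb rewrite_chain_cde
      not_rewrite_single_plex)

lemma final_words_chain: "final_words fish chain = chain_words"
  by (auto simp: final_words_def finals_chain single_plex_def)

section \<open>Concurrency of the chain\<close>

lemma motif_fish: "motif fish"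
proof -
  have "plex_diagram ({vt1, vt2, vp}, {{vt1, vt2, vp}}, {})"
    by (rule plex_diagram_single) auto
  from plex_diagram_insert[OF this, of "{vp, vq, vr}" "{}"]
  have "plex_diagram ({vt1, vt2, vp} \<union> {vp, vq, vr}, {{vp, vq, vr}, {vt1, vt2, vp}}, {})"
    by simp
  from plex_diagram_insert[OF this, of "{vq, vr, vm}" "{vp, vq, vr}"]
  show ?thesis
    by (auto simp: motif_def fish_def insert_commute insert_eq_iff)
qed

lemma initial_chain: "initial_diagram chain"
proof -
  \<comment> \<open>The chain is grown from \<open>ea\<close> to \<open>ee\<close>, each new edge
    meeting the previous one; the marks are set with the last edge.\<close>
  have "plex_diagram ({1, 2, 3}, {{1, 2, 3}}, {} :: nat set)"
    by (rule plex_diagram_single) auto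
  from plex_diagram_insert[OF this, of "{3, 4, 5}" "{}"]
  have "plex_diagram ({1, 2, 3, 4, 5}, {{3, 4, 5}, {1, 2, 3}}, {} :: nat set)"
    by (simp add: insert_commute)
  from plex_diagram_insert[OF this, of "{4, 5, 6}" "{}"]
  have "plex_diagram ({1, 2, 3, 4, 5, 6}, {{4, 5, 6}, {3, 4, 5}, {1, 2, 3}}, {} :: nat set)"
    by (simp add: insert_commute)
  from plex_diagram_insert[OF this, of "{6, 7, 8}" "{}"]
  have "plex_diagram ({1, 2, 3, 4, 5, 6, 7, 8},
      {{6, 7, 8}, {4, 5, 6}, {3, 4, 5}, {1, 2, 3}}, {} :: nat set)"
    by (simp add: insert_commute)
  from plex_diagram_insert[OF this, of "{7, 8, 9}" "{3, 4, 5, 6, 7, 8}"]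
  have "plex_diagram ({1, 2, 3, 4, 5, 6, 7, 8, 9},
      {{7, 8, 9}, {6, 7, 8}, {4, 5, 6}, {3, 4, 5}, {1, 2, 3}}, {3, 4, 5, 6, 7, 8 :: nat})"
    by (simp add: insert_commute)
  then have "plex_diagram (unlabel chain)"
    by (simp add: unlabel_def chain_def insert_commute)
  moreover have "inj_on fst (edges chain)"
    by (simp add: chain_def set_eq_subset)
  moreover have "inj_on snd (edges chain)" "snd ` edges chain \<subseteq> range Letter"
    by (simp_all add: chain_def)
  ultimately show ?thesis
    by (simp add: initial_diagram_def)
qed

lemma concurrent_chain: "concurrent fish chain"
proof -
  have "confluent fish chain"
    \<comment> \<open>The final diagrams are \<open>single_plex w\<close> for three words
      \<open>w\<close>, and \<open>unlabel\<close> forgets \<open>w\<close>.\<close>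
    by (simp add: confluent_def finals_chain single_plex_def unlabel_def)
  moreover have "regular fish chain"
    unfolding regular_def reachable_chain
    by (rule exI[of _ 3])
      (auto simp: chain_def chain_abc_def chain_dcb_def chain_cde_def single_plex_def)
  moreover have "overlapping fish chain"
  proof -
    have mem: "ea \<in> edges chain" "eb \<in> edges chain" "ec \<in> edges chain" "ed \<in> edges chain" "ee \<in> edges chain"
      by (simp_all add: chain_def)
    have "fish_at chain ea eb ec" "fish_at chain ec ed ee"
      using mem by (simp_all only: fish_at_chain insert_iff simp_thms)
    then have occ: "{ea, eb, ec} \<in> occurrences fish chain" "{ec, ed, ee} \<in> occurrences fish chain"
      using mem by (simp_all only: fish_at_in_occurrences)
    have neq: "{ea, eb, ec} \<noteq> {ec, ed, ee}"
      by (simp add: set_eq_subset)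
    \<comment> \<open>The middle plex is the head of (abc), the body of (dcb) and the tail of
      (cde).\<close>
    have "ec \<in> X" if X: "X \<in> occurrences fish chain" for X
    proof -
      obtain x y z where xyz: "X = {x, y, z}" "x \<in> edges chain" "y \<in> edges chain" "z \<in> edges chain"
        and "fish_at chain x y z"
        using X unfolding occurrences_fish mem_Collect_eq by metis
      then have "x = ec \<or> y = ec \<or> z = ec"
        by (simp only: fish_at_chain insert_iff empty_iff prod.inject) (elim disjE conjE FalseE; simp only: simp_thms)
      then show ?thesis
        unfolding \<open>X = {x, y, z}\<close> by (elim disjE) simp_all
    qed
    then have "ec \<in> \<Inter>(occurrences fish chain)"
      by (rule InterI)
    then have "\<Inter>(occurrences fish chain) \<noteq> {}"
      by (metis empty_iff)
    then show ?thesis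
      unfolding overlapping_def
      by (intro conjI bexI[of _ "{ea, eb, ec}"] bexI[of _ "{ec, ed, ee}"] neq occ)
  qed
  ultimately show ?thesis
    by (simp add: concurrent_def motif_fish initial_chain)
qed

section \<open>The symbolic condition of the chain\<close>

text \<open>Under an assignment of \<open>a\<close>, ..., \<open>e\<close> to the letters 0 to 4,
  the three final words evaluate to the three members of the semiheap axiom.\<close>

lemma symbolic_condition_chain:
  assumes closed: "ternary_closed H t"
  shows "symbolic_condition fish chain H (ternary t) \<longleftrightarrow> semiheap H t"
proof
  assume sym: "symbolic_condition fish chain H (ternary t)"
  have "t (t a b c) d e = t a (t d c b) e \<and> t a (t d c b) e = t a b (t c d e)"
    if H: "a \<in> H" "b \<in> H" "c \<in> H" "d \<in> H" "e \<in> H" for a b c d e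
  proof -
    \<comment> \<open>All letters from 4 on are sent to \<open>e\<close>, so that the assignment
      takes values in \<open>H\<close> everywhere.\<close>
    define \<rho> :: "nat \<Rightarrow> _" where
      "\<rho> n = (if n = 0 then a else if n = 1 then b else if n = 2 then c else if n = 3 then d else e)" for n
    have "\<forall>n. \<rho> n \<in> H"
      using H by (simp add: \<rho>_def)
    then have "eval_word (ternary t) \<rho> w = eval_word (ternary t) \<rho> w'"
      if "w \<in> chain_words" "w' \<in> chain_words" for w w'
      using sym that unfolding symbolic_condition_def final_words_chain by blast
    from this[of "fish_word wabc (Letter 3) (Letter 4)" "fish_word (Letter 0) wdcb (Letter 4)"]
      this[of "fish_word (Letter 0) wdcb (Letter 4)" "fish_word (Letter 0) (Letter 1) wcde"]
    show ?thesis
      by (simp add: ternary_def \<rho>_def)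
  qed
  then show "semiheap H t"
    using closed by (simp add: semiheap_def)
next
  assume "semiheap H t"
  then show "symbolic_condition fish chain H (ternary t)"
    by (simp add: symbolic_condition_def final_words_chain ternary_def semiheap_def)
qed

theorem theorem6p1:
  "associative fish \<and>
   (\<exists>(D :: (nat, nat) diagram) a b c d e.
      concurrent fish D \<and>
      (\<forall>D' :: ('v, 'l) diagram. concurrent fish D' \<longrightarrow> card (edges D) \<le> card (edges D')) \<and>
      distinct [a, b, c, d, e] \<and>
      snd ` edges D = Letter ` {a, b, c, d, e} \<and>
      final_words fish D =
        {fish_word (fish_word (Letter a) (Letter b) (Letter c)) (Letter d) (Letter e),
         fish_word (Letter a) (fish_word (Letter d) (Letter c) (Letter b)) (Letter e),
         fish_word (Letter a) (Letter b) (fish_word (Letter c) (Letter d) (Letter e))} \<and>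
      (\<forall>(H :: 'h set) t. ternary_closed H t \<longrightarrow>
         (symbolic_condition fish D H (ternary t) \<longleftrightarrow> semiheap H t)))"
proof
  show "associative fish"
    using concurrent_chain by (auto simp: associative_def)
  have "card (edges chain) = 5"
    by (simp add: chain_def)
  \<comment> \<open>The lower bound holds for all vertex and letter types, hence also for diagrams
    over types other than those of the chain.\<close>
  then have min: "card (edges chain) \<le> card (edges D')" if "concurrent fish D'"
    for D' :: "('v, 'l) diagram"
    using concurrent_fish_card_ge_5[OF that] by simp
  show "\<exists>(D :: (nat, nat) diagram) a b c d e.
      concurrent fish D \<and>
      (\<forall>D' :: ('v, 'l) diagram. concurrent fish D' \<longrightarrow> card (edges D) \<le> card (edges D')) \<and>
      distinct [a, b, c, d, e] \<and>
      snd ` edges D = Letter ` {a, b, c, d, e} \<and>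
      final_words fish D =
        {fish_word (fish_word (Letter a) (Letter b) (Letter c)) (Letter d) (Letter e),
         fish_word (Letter a) (fish_word (Letter d) (Letter c) (Letter b)) (Letter e),
         fish_word (Letter a) (Letter b) (fish_word (Letter c) (Letter d) (Letter e))} \<and>
      (\<forall>(H :: 'h set) t. ternary_closed H t \<longrightarrow>
         (symbolic_condition fish D H (ternary t) \<longleftrightarrow> semiheap H t))"
  proof (intro exI conjI allI impI)
    show "concurrent fish chain"
      by (rule concurrent_chain)
    show "card (edges chain) \<le> card (edges D')" if "concurrent fish D'" for D' :: "('v, 'l) diagram"
      using that by (rule min)
    \<comment> \<open>The letters witnessing a to e are the labels of \<open>ea\<close> to
      \<open>ee\<close>.\<close>
    show "distinct [0, 1, 2, 3, 4 :: nat]"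
      by simp
    show "snd ` edges chain = Letter ` {0, 1, 2, 3, 4}"
      by (simp add: chain_def)
    show "final_words fish chain = chain_words"
      by (rule final_words_chain)
    show "symbolic_condition fish chain H (ternary t) \<longleftrightarrow> semiheap H t"
      if "ternary_closed H t" for H :: "'h set" and t
      using that by (rule symbolic_condition_chain)
  qed
qed

end
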